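(* Let $\mathcal{H}$ be a real Hilbert space, let $m\ge2$ be an integer, and let $U_1,\ldots,U_m$ be closed linear subspaces of $\mathcal{H}$ such that $U_1^\perp+\cdots+U_m^\perp$ is closed. Let $$\Omega:=\{\mathrm{R}_{U_{i_r}}\cdots\mathrm{R}_{U_{i_2}}\mathrm{R}_{U_{i_1}} : r\in\mathbb{N},\ i_1,\ldots,i_r\in\{1,\ldots,m\}\},$$ $$\Psi:=\{\mathrm{R}_{U_{i_r}}\cdots\mathrm{R}_{U_{i_2}}\mathrm{R}_{U_{i_1}} : r\in\{0,1,\ldots,m\},\ i_1,\ldots,i_r\in\{1,\ldots,m\},\ i_1<\cdots<i_r\},$$ (with the empty product, $r=0$, equal to $\mathrm{Id}$), and let $\mathcal{S}$ be a finite set with $\Psi\subseteq\mathcal{S}\subseteq\Omega$. Set $\gamma:=\big\|\mathrm{P}_{U_m}\mathrm{P}_{U_{m-1}}\cdots\mathrm{P}_{U_1}\mathrm{P}_{(\bigcap_{i=1}^mU_i)^\perp}\big\|$. Then $\gamma\in[0,1[$, $\operatorname{Fix}CC_{\mathcal{S}}=\bigcap_{i=1}^mU_i$, and the circumcenter mapping $CC_{\mathcal{S}}$ is a $\gamma$-BAM.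
   Context: For a nonempty closed convex set $C\subseteq\mathcal{H}$, $\mathrm{P}_C$ denotes the metric projection onto $C$ and $\mathrm{R}_C:=2\mathrm{P}_C-\mathrm{Id}$ the reflector. $\operatorname{Fix}G=\{x\in\mathcal{H}: Gx=x\}$. $\mathbb{N}=\{0,1,2,\ldots\}$. Products of operators denote composition; $\|\cdot\|$ of a bounded linear operator is the operator norm. Definition (BAM). Let $G:\mathcal{H}\to\mathcal{H}$ and $\gamma\in[0,1[$. $G$ is a best approximation mapping with constant $\gamma$ ($\gamma$-BAM) if (1) $\operatorname{Fix}G$ is a nonempty closed convex subset of $\mathcal{H}$; (2) $\mathrm{P}_{\operatorname{Fix}G}G=\mathrm{P}_{\operatorname{Fix}G}$; (3) $\|Gx-\mathrm{P}_{\operatorname{Fix}G}x\|\le\gamma\|x-\mathrm{P}_{\operatorname{Fix}G}x\|$ for all $x\in\mathcal{H}$. Circumcenter mapping: for a finite set $\mathcal{S}$ of affine isometries of $\mathcal{H}$ having a common fixed point (e.g. compositions of reflectors in closed linear subspaces), and $x\in\mathcal{H}$, $CC_{\mathcal{S}}x$ is the unique point $p$ in the affine hull of $\mathcal{S}(x)=\{Tx:T\in\mathcal{S}\}$ such that $\{\|p-Tx\|:T\in\mathcal{S}\}$ is a singleton. It is a known fact that such a point exists and is unique for every $x$, so $CC_{\mathcal{S}}:\mathcal{H}\to\mathcal{H}$ is well defined. *)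

theory Defs
  imports "HOL-Analysis.Analysis"
begin

text \<open>
  A real Hilbert space is a type of sort \<open>{real_inner, complete_space}\<close>, of arbitrary dimension.
  The library's \<open>closest_point\<close> is restricted to Heine-Borel (hence finite-dimensional) spaces,
  so the metric projection is defined here. It is meaningful for nonempty closed convex \<open>C\<close>,
  where the nearest point exists and is unique.
\<close>

definition metric_proj :: "'a::{real_inner, complete_space} set \<Rightarrow> 'a \<Rightarrow> 'a" where
  "metric_proj C x = (THE p. p \<in> C \<and> (\<forall>q\<in>C. norm (x - p) \<le> norm (x - q)))"

definition reflector :: "'a::{real_inner, complete_space} set \<Rightarrow> 'a \<Rightarrow> 'a" where
  "reflector C x = 2 *\<^sub>R metric_proj C x - x"

definition Fix :: "('a \<Rightarrow> 'a) \<Rightarrow> 'a set" where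
  "Fix G = {x. G x = x}"

definition is_BAM :: "real \<Rightarrow> ('a::{real_inner, complete_space} \<Rightarrow> 'a) \<Rightarrow> bool" where
  "is_BAM \<gamma> G \<longleftrightarrow>
     0 \<le> \<gamma> \<and> \<gamma> < 1 \<and>
     Fix G \<noteq> {} \<and> closed (Fix G) \<and> convex (Fix G) \<and>
     metric_proj (Fix G) \<circ> G = metric_proj (Fix G) \<and>
     (\<forall>x. norm (G x - metric_proj (Fix G) x) \<le> \<gamma> * norm (x - metric_proj (Fix G) x))"

text \<open>
  The circumcenter of the point set \<open>{T x | T \<in> S}\<close>. Existence and uniqueness hold whenever \<open>S\<close>
  is a nonempty finite set of affine isometries with a common fixed point.
\<close>

definition circumcenter_map ::
    "('a::{real_inner, complete_space} \<Rightarrow> 'a) set \<Rightarrow> 'a \<Rightarrow> 'a" where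
  "circumcenter_map S x =
     (THE p. p \<in> affine hull ((\<lambda>T. T x) ` S) \<and> is_singleton ((\<lambda>T. norm (p - T x)) ` S))"

text \<open>
  For an index list \<open>[i\<^sub>1, \<dots>, i\<^sub>r]\<close> this is \<open>F i\<^sub>r \<circ> \<dots> \<circ> F i\<^sub>1\<close>: the head of the list is applied first.
\<close>

definition op_prod :: "(nat \<Rightarrow> 'a \<Rightarrow> 'a) \<Rightarrow> nat list \<Rightarrow> 'a \<Rightarrow> 'a" where
  "op_prod F js = fold (\<lambda>i G. F i \<circ> G) js id"

definition refl_Omega ::
    "nat \<Rightarrow> (nat \<Rightarrow> 'a::{real_inner, complete_space} set) \<Rightarrow> ('a \<Rightarrow> 'a) set" where
  "refl_Omega m U = {op_prod (\<lambda>i. reflector (U i)) js | js. set js \<subseteq> {1..m}}"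

definition refl_Psi ::
    "nat \<Rightarrow> (nat \<Rightarrow> 'a::{real_inner, complete_space} set) \<Rightarrow> ('a \<Rightarrow> 'a) set" where
  "refl_Psi m U = {op_prod (\<lambda>i. reflector (U i)) js | js.
     length js \<le> m \<and> set js \<subseteq> {1..m} \<and> sorted_wrt (<) js}"

end

(* Put M = \<Inter> U i. The circumcenter of S(x) is the nearest point of aff S(x) to every z in M, since the
   members of S are isometries fixing M. Writing each projection as the mean of the identity and a
   reflector shows that P_m ... P_1 x lies in aff Psi(x), so the circumcenter is at least as close to P_M x
   as P_m ... P_1 x is; this gives the contraction estimate with constant gamma.

   That gamma < 1 is linear regularity: if the sum of the U i\<^sup>\<bottom> is closed, it equals M\<^sup>\<bottom>, and then
   norm x \<le> \<kappa> max_i dist(x, U i) on M\<^sup>\<bottom>. This follows from uniform boundedness, without an open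
   mapping theorem: the set of y in M\<^sup>\<bottom> with dist(y, U i) \<le> 1 for all i is weakly bounded, because
   for v = \<Sum> s i with s i in U i\<^sup>\<bottom> one has y \<bullet> v = \<Sum> (y - P_i y) \<bullet> s i. A vector that the product of
   the projections hardly shortens is close to every U i, so by regularity it is small. *)

theory Submission
  imports Defs
begin

section \<open>Projection onto closed subspaces\<close>

lemma norm_diff_sq: "(norm (x - y))\<^sup>2 = (norm x)\<^sup>2 - 2 * (x \<bullet> y) + (norm y)\<^sup>2"
  for x y :: "'a::real_inner"
  by (simp add: power2_norm_eq_inner inner_diff inner_commute)

lemma norm_diff_pythagoras:
  fixes x p q :: "'a::real_inner"
  assumes "(x - p) \<bullet> (q - p) = 0"
  shows "(norm (x - q))\<^sup>2 = (norm (x - p))\<^sup>2 + (norm (q - p))\<^sup>2"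
proof -
  have "x - q = (x - p) - (q - p)" by simp
  then show ?thesis using assms norm_diff_sq[of "x - p" "q - p"] by simp
qed

text \<open>A minimizing sequence for the distance from \<open>x\<close> to \<open>U\<close> is
  Cauchy by the parallelogram law. Its limit \<open>p\<close> attains the distance, and minimality
  along the lines through \<open>p\<close> in \<open>U\<close> forces orthogonality.\<close>

lemma closed_subspace_orthogonal_decomposition:
  fixes U :: "'a::{real_inner, complete_space} set"
  assumes U: "subspace U" and cl: "closed U"
  obtains p where "p \<in> U" "\<And>u. u \<in> U \<Longrightarrow> (x - p) \<bullet> u = 0"
proof -
  define D where "D = (INF u\<in>U. (norm (x - u))\<^sup>2)"
  have ne: "U \<noteq> {}" using subspace_0[OF U] by auto
  have bdd: "bdd_below ((\<lambda>u. (norm (x - u))\<^sup>2) ` U)" by (rule bdd_belowI[of _ 0]) auto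
  have D: "D \<le> (norm (x - u))\<^sup>2" if "u \<in> U" for u
    unfolding D_def by (rule cINF_lower[OF bdd that])
  have "\<exists>u\<in>U. (norm (x - u))\<^sup>2 < D + 1 / real (Suc n)" for n
    using cINF_less_iff[OF ne bdd, of "D + 1 / real (Suc n)"] unfolding D_def by simp
  then obtain f where fU: "\<And>n. f n \<in> U"
    and f: "\<And>n. (norm (x - f n))\<^sup>2 < D + 1 / real (Suc n)" by metis
  \<comment> \<open>The midpoint of \<open>f i\<close> and \<open>f j\<close> stays in
    \<open>U\<close>, so its squared distance to \<open>x\<close> is at least \<open>D\<close>; this
    bounds the remaining diagonal of the parallelogram.\<close>
  have par: "(norm (f i - f j))\<^sup>2 \<le> 2 / real (Suc i) + 2 / real (Suc j)" for i j
  proof -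
    let ?c = "(1/2) *\<^sub>R (f i + f j)"
    have "?c \<in> U" using U fU by (simp add: subspace_add subspace_scale)
    then have "D \<le> (norm (x - ?c))\<^sup>2" by (rule D)
    moreover have "(norm (f i - f j))\<^sup>2 + 4 * (norm (x - ?c))\<^sup>2
        = 2 * (norm (x - f i))\<^sup>2 + 2 * (norm (x - f j))\<^sup>2"
      by (simp add: power2_norm_eq_inner inner_diff inner_add inner_commute algebra_simps)
    ultimately show ?thesis using f[of i] f[of j] by simp
  qed
  have "Cauchy f"
  proof (rule metric_CauchyI)
    fix e :: real assume e: "e > 0"
    obtain N where N: "4 / e\<^sup>2 < real N" using reals_Archimedean2 by blast
    have "dist (f i) (f j) < e" if "i \<ge> N" "j \<ge> N" for i j
    proof -
      have N0: "0 < real (Suc N)" by simp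
      have "(norm (f i - f j))\<^sup>2 \<le> 2 / real (Suc i) + 2 / real (Suc j)" by (rule par)
      also have "\<dots> \<le> 2 / real (Suc N) + 2 / real (Suc N)"
        using that by (intro add_mono divide_left_mono) auto
      also have "\<dots> = 4 / real (Suc N)" by simp
      also have "\<dots> < e\<^sup>2"
        using N e by (simp add: field_simps add_strict_increasing)
      finally show ?thesis using e by (simp add: dist_norm power2_less_imp_less)
    qed
    then show "\<exists>M. \<forall>m\<ge>M. \<forall>n\<ge>M. dist (f m) (f n) < e" by blast
  qed
  then obtain p where p: "f \<longlonglongrightarrow> p" using Cauchy_convergent convergent_def by blast
  have pU: "p \<in> U" using closed_sequentially[OF cl _ p] fU by blast
  have "(norm (x - p))\<^sup>2 \<le> D + 0"
  proof (rule LIMSEQ_le)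
    show "(\<lambda>n. (norm (x - f n))\<^sup>2) \<longlonglongrightarrow> (norm (x - p))\<^sup>2" by (intro tendsto_intros p)
    show "(\<lambda>n. D + 1 / real (Suc n)) \<longlonglongrightarrow> D + 0"
      using LIMSEQ_inverse_real_of_nat by (intro tendsto_intros) (simp add: inverse_eq_divide)
    show "\<exists>N. \<forall>n\<ge>N. (norm (x - f n))\<^sup>2 \<le> D + 1 / real (Suc n)" using f less_imp_le by blast
  qed
  then have min: "(norm (x - p))\<^sup>2 \<le> (norm (x - u))\<^sup>2" if "u \<in> U" for u
    using D[OF that] by (metis add_0_right order_trans)
  have "(x - p) \<bullet> u = 0" if u: "u \<in> U" for u
  proof (cases "u = 0")
    case False
    \<comment> \<open>\<open>t *\<^sub>R u\<close> is the projection of \<open>x - p\<close> onto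
      the line of \<open>u\<close>. Moving \<open>p\<close> by it lowers the squared distance by the
      quotient computed below, which minimality allows only if it is zero.\<close>
    define t where "t = ((x - p) \<bullet> u) / (u \<bullet> u)"
    have uu: "u \<bullet> u > 0" using False by simp
    have "(norm (x - p))\<^sup>2 \<le> (norm (x - (p + t *\<^sub>R u)))\<^sup>2"
      by (rule min) (use U pU u in \<open>simp add: subspace_add subspace_scale\<close>)
    also have "\<dots> = (norm ((x - p) - t *\<^sub>R u))\<^sup>2" by (simp add: algebra_simps)
    also have "\<dots> = (norm (x - p))\<^sup>2 - 2 * t * ((x - p) \<bullet> u) + t\<^sup>2 * (u \<bullet> u)"
      unfolding norm_diff_sq by (simp add: power_mult_distrib power2_norm_eq_inner)
    also have "\<dots> = (norm (x - p))\<^sup>2 - ((x - p) \<bullet> u)\<^sup>2 / (u \<bullet> u)"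
      using uu by (simp add: t_def power2_eq_square field_simps)
    finally have "((x - p) \<bullet> u)\<^sup>2 / (u \<bullet> u) \<le> 0" by simp
    then show ?thesis using uu by (simp add: divide_le_0_iff)
  qed simp
  with pU show ?thesis by (rule that)
qed

text \<open>By Pythagoras the squared distance from \<open>x\<close> to another \<open>q\<close> in
  \<open>U\<close> exceeds that to \<open>p\<close> by \<open>(norm (q - p))\<^sup>2\<close>, which
  gives both existence and uniqueness for the definite description.\<close>

lemma metric_proj_eqI:
  fixes U :: "'a::{real_inner, complete_space} set"
  assumes U: "subspace U" and p: "p \<in> U" and orth: "\<And>u. u \<in> U \<Longrightarrow> (x - p) \<bullet> u = 0"
  shows "metric_proj U x = p"
proof -
  have pyth: "(norm (x - q))\<^sup>2 = (norm (x - p))\<^sup>2 + (norm (q - p))\<^sup>2" if "q \<in> U" for q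
    using U p that by (intro norm_diff_pythagoras orth subspace_diff)
  show ?thesis unfolding metric_proj_def
  proof (rule the_equality)
    have "norm (x - p) \<le> norm (x - q)" if "q \<in> U" for q
      using pyth[OF that] by - (rule power2_le_imp_le, simp_all)
    with p show "p \<in> U \<and> (\<forall>q\<in>U. norm (x - p) \<le> norm (x - q))" by blast
  next
    fix q assume q: "q \<in> U \<and> (\<forall>r\<in>U. norm (x - q) \<le> norm (x - r))"
    then have "(norm (x - q))\<^sup>2 \<le> (norm (x - p))\<^sup>2" using p by (intro power_mono) auto
    then have "(norm (q - p))\<^sup>2 \<le> 0" using pyth[of q] q by linarith
    then show "q = p" by simp
  qed
qed

section \<open>Linearity and norms of the projection and the reflector\<close>

context
  fixes U :: "'a::{real_inner, complete_space} set"
  assumes U: "subspace U" "closed U"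
begin

lemma metric_proj_in: "metric_proj U x \<in> U"
  and metric_proj_orthogonal: "u \<in> U \<Longrightarrow> (x - metric_proj U x) \<bullet> u = 0"
proof -
  obtain p where "p \<in> U" "\<And>u. u \<in> U \<Longrightarrow> (x - p) \<bullet> u = 0"
    using closed_subspace_orthogonal_decomposition[OF U] by blast
  then show "metric_proj U x \<in> U" "u \<in> U \<Longrightarrow> (x - metric_proj U x) \<bullet> u = 0"
    using metric_proj_eqI[OF U(1)] by metis+
qed

lemma metric_proj_id: "x \<in> U \<Longrightarrow> metric_proj U x = x"
  by (rule metric_proj_eqI[OF U(1)]) auto

lemma metric_proj_pythagoras:
  "(norm x)\<^sup>2 = (norm (metric_proj U x))\<^sup>2 + (norm (x - metric_proj U x))\<^sup>2"
proof -
  have "(x - metric_proj U x) \<bullet> metric_proj U x = 0"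
    by (rule metric_proj_orthogonal[OF metric_proj_in])
  then show ?thesis
    by (simp add: power2_norm_eq_inner inner_diff inner_commute)
qed

lemma norm_metric_proj_le: "norm (metric_proj U x) \<le> norm x"
  using metric_proj_pythagoras[of x] by - (rule power2_le_imp_le, simp_all)

lemma metric_proj_nearest:
  assumes "u \<in> U"
  shows "norm (x - metric_proj U x) \<le> norm (x - u)"
proof -
  have "(x - metric_proj U x) \<bullet> (u - metric_proj U x) = 0"
    by (intro metric_proj_orthogonal subspace_diff U assms metric_proj_in)
  from norm_diff_pythagoras[OF this] show ?thesis
    by - (rule power2_le_imp_le, simp_all)
qed

lemma bounded_linear_metric_proj: "bounded_linear (metric_proj U)"
proof (rule bounded_linear_intro[where K = 1])
  show "metric_proj U (x + y) = metric_proj U x + metric_proj U y" for x y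
  proof (rule metric_proj_eqI[OF U(1)])
    show "metric_proj U x + metric_proj U y \<in> U"
      by (intro subspace_add U metric_proj_in)
    fix u assume "u \<in> U"
    then show "(x + y - (metric_proj U x + metric_proj U y)) \<bullet> u = 0"
      using metric_proj_orthogonal[of u x] metric_proj_orthogonal[of u y]
      by (simp add: inner_diff inner_add)
  qed
  show "metric_proj U (c *\<^sub>R x) = c *\<^sub>R metric_proj U x" for c x
  proof (rule metric_proj_eqI[OF U(1)])
    show "c *\<^sub>R metric_proj U x \<in> U"
      by (intro subspace_scale U metric_proj_in)
    fix u assume "u \<in> U"
    then show "(c *\<^sub>R x - c *\<^sub>R metric_proj U x) \<bullet> u = 0"
      using metric_proj_orthogonal[of u x] by (simp add: inner_diff)
  qed
  show "norm (metric_proj U x) \<le> norm x * 1" for x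
    using norm_metric_proj_le by simp
qed

lemma bounded_linear_reflector: "bounded_linear (reflector U)"
proof -
  have "reflector U = (\<lambda>x. 2 *\<^sub>R metric_proj U x - x)"
    by (simp add: fun_eq_iff reflector_def)
  then show ?thesis
    by (simp add: bounded_linear_sub bounded_linear_scaleR_right bounded_linear_ident
        bounded_linear_compose[OF bounded_linear_scaleR_right bounded_linear_metric_proj])
qed

lemma metric_proj_eq_midpoint_reflector:
  "metric_proj U x = (1/2) *\<^sub>R x + (1/2) *\<^sub>R reflector U x"
  by (simp add: reflector_def algebra_simps)

text \<open>The reflector only flips the sign of \<open>x - metric_proj U x\<close>, which is
  orthogonal to the other component of \<open>x\<close>.\<close>

lemma norm_reflector: "norm (reflector U x) = norm x"
proof -
  have "metric_proj U x \<bullet> metric_proj U x = x \<bullet> metric_proj U x"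
    using metric_proj_orthogonal[OF metric_proj_in, of x x] by (simp add: inner_diff)
  then have "(norm (reflector U x))\<^sup>2 = (norm x)\<^sup>2"
    by (simp add: reflector_def power2_norm_eq_inner inner_diff inner_commute)
  then show ?thesis by simp
qed

lemma inner_reflector: "z \<in> U \<Longrightarrow> reflector U x \<bullet> z = x \<bullet> z"
  using metric_proj_orthogonal[of z x] by (simp add: reflector_def inner_diff)

end

section \<open>Orthogonal complements\<close>

lemma closed_orthogonal_comp: "closed (W\<^sup>\<bottom>)"
proof -
  have "W\<^sup>\<bottom> = (\<Inter>y\<in>W. {x. y \<bullet> x = 0})"
    by (auto simp: orthogonal_comp_def orthogonal_def)
  then show ?thesis by (auto intro!: closed_INT closed_hyperplane)
qed

text \<open>For \<open>x\<close> in the double complement, the residual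
  \<open>x - metric_proj U x\<close> is orthogonal to \<open>x\<close> and to its projection, hence
  to itself.\<close>

lemma orthogonal_comp_comp:
  fixes U :: "'a::{real_inner, complete_space} set"
  assumes "subspace U" "closed U"
  shows "U\<^sup>\<bottom>\<^sup>\<bottom> = U"
proof
  show "U\<^sup>\<bottom>\<^sup>\<bottom> \<subseteq> U"
  proof
    fix x assume x: "x \<in> U\<^sup>\<bottom>\<^sup>\<bottom>"
    let ?r = "x - metric_proj U x"
    have 1: "?r \<bullet> u = 0" if "u \<in> U" for u using metric_proj_orthogonal[OF assms that] .
    then have "?r \<in> U\<^sup>\<bottom>" by (simp add: orthogonal_comp_def orthogonal_def inner_commute)
    with x have "?r \<bullet> x = 0" by (simp add: orthogonal_comp_def orthogonal_def)
    with 1[OF metric_proj_in[OF assms]] have "?r \<bullet> ?r = 0" by (simp add: inner_diff_right)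
    then have "x = metric_proj U x" by simp
    then show "x \<in> U" using metric_proj_in[OF assms, of x] by simp
  qed
qed (rule orthogonal_comp_subset)

section \<open>Uniform boundedness\<close>

text \<open>Gliding hump: the vectors \<open>v n\<close> are partial sums of \<open>\<Sum>k. \<plusminus>3\<^sup>-\<^sup>k sgn (y k)\<close>, with the signs chosen
  so that \<open>y n\<close> is large on \<open>v (Suc n)\<close>; the remaining terms can undo at most half of this.\<close>

lemma bounded_if_weakly_bounded:
  fixes Y :: "'a::{real_inner, complete_space} set"
  assumes weak: "\<And>v. bounded ((\<lambda>y. y \<bullet> v) ` Y)"
  shows "bounded Y"
proof (rule ccontr)
  assume "\<not> bounded Y"
  then have "\<exists>y\<in>Y. norm y > b" for b by (meson boundedI not_le)
  \<comment> \<open>The factor \<open>3 ^ n\<close> cancels the weight of the n-th hump, and the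
    factor 2 pays for the half that the tail can undo.\<close>
  then have "\<exists>y\<in>Y. norm y > 2 * real n * 3 ^ n" for n by blast
  then obtain y where yY: "\<And>n. y n \<in> Y" and y: "\<And>n. norm (y n) > 2 * real n * 3 ^ n" by metis
  define w where "w n = (1/3) ^ n *\<^sub>R sgn (y n)" for n
  define v where "v = rec_nat 0 (\<lambda>n u. if y n \<bullet> u \<ge> 0 then u + w n else u - w n)"
  have v: "v (Suc n) = (if y n \<bullet> v n \<ge> 0 then v n + w n else v n - w n)" for n
    by (simp add: v_def)
  have w: "norm (w n) \<le> (1/3) ^ n" for n by (simp add: w_def norm_sgn)
  have yw: "y n \<bullet> w n = (1/3) ^ n * norm (y n)" for n
    by (cases "y n = 0")
      (simp_all add: w_def sgn_div_norm power2_norm_eq_inner[symmetric] power2_eq_square field_simps)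
  have big: "\<bar>y n \<bullet> v (Suc n)\<bar> \<ge> (1/3) ^ n * norm (y n)" for n
  proof -
    have "0 \<le> (1/3) ^ n * norm (y n)" by simp
    moreover have "y n \<bullet> v (Suc n) = (if y n \<bullet> v n \<ge> 0
        then y n \<bullet> v n + (1/3) ^ n * norm (y n) else y n \<bullet> v n - (1/3) ^ n * norm (y n))"
      by (simp add: v inner_add_right inner_diff_right yw)
    ultimately show ?thesis by (smt (verit))
  qed
  have step: "norm (v (Suc n) - v n) \<le> (1/3) ^ n" for n using w[of n] by (simp add: v)
  \<comment> \<open>The right-hand side is the exact geometric sum of the steps; without the
    subtracted term the induction would not close.\<close>
  have tail: "norm (v (n + k) - v n) \<le> 3/2 * ((1/3) ^ n - (1/3) ^ (n + k))" for n k
  proof (induction k)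
    case (Suc k)
    have "norm (v (n + Suc k) - v n) \<le> norm (v (Suc (n + k)) - v (n + k)) + norm (v (n + k) - v n)"
      by (rule order_trans[OF _ norm_triangle_ineq]) simp
    with Suc step[of "n + k"] show ?case by simp
  qed simp
  have tail': "norm (v i - v n) \<le> 3/2 * (1/3) ^ n" if "i \<ge> n" for i n
  proof -
    have "norm (v i - v n) \<le> 3/2 * ((1/3) ^ n - (1/3) ^ i)"
      using tail[of n "i - n"] that by simp
    also have "\<dots> \<le> 3/2 * (1/3) ^ n" by simp
    finally show ?thesis .
  qed
  have "Cauchy v"
  proof (rule CauchyI')
    fix e :: real assume "e > 0"
    then obtain N where N: "(1/3 :: real) ^ N < e / 2"
      using real_arch_pow_inv[of "e/2" "1/3"] by auto
    have "dist (v m) (v n) < e" if "m \<ge> N" "n > m" for m n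
    proof -
      have "dist (v m) (v n) \<le> 3/2 * (1/3) ^ m"
        using tail'[of m n] that by (simp add: dist_norm norm_minus_commute)
      also have "\<dots> \<le> 3/2 * (1/3) ^ N" using that by (simp add: power_decreasing)
      also have "\<dots> < e" using N \<open>e > 0\<close> by simp
      finally show ?thesis .
    qed
    then show "\<exists>M. \<forall>m\<ge>M. \<forall>n>m. dist (v m) (v n) < e" by blast
  qed
  then obtain l where l: "v \<longlonglongrightarrow> l" using Cauchy_convergent convergent_def by blast
  have lim: "norm (l - v n) \<le> 3/2 * (1/3) ^ n" for n
  proof (rule LIMSEQ_le_const2)
    show "(\<lambda>i. norm (v i - v n)) \<longlonglongrightarrow> norm (l - v n)" by (intro tendsto_intros l)
    show "\<exists>N. \<forall>i\<ge>N. norm (v i - v n) \<le> 3/2 * (1/3) ^ n" using tail' by blast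
  qed
  obtain B where B: "\<And>z. z \<in> Y \<Longrightarrow> \<bar>z \<bullet> l\<bar> \<le> B"
    using weak[of l] by (auto simp: bounded_iff)
  obtain n where n: "B < real n" using reals_Archimedean2 by blast
  \<comment> \<open>The tail bound at \<open>Suc n\<close> is 3/2 times 1/3, that is 1/2, of
    \<open>(1/3) ^ n\<close>: half of the lower bound in \<open>big\<close>.\<close>
  have "\<bar>y n \<bullet> (l - v (Suc n))\<bar> \<le> norm (y n) * (1/2 * (1/3) ^ n)"
    using lim[of "Suc n"]
    by (intro order_trans[OF Cauchy_Schwarz_ineq2] mult_left_mono) simp_all
  also have "\<dots> = 1/2 * ((1/3) ^ n * norm (y n))" by simp
  finally have "\<bar>y n \<bullet> l\<bar> \<ge> 1/2 * ((1/3) ^ n * norm (y n))"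
    using big[of n] unfolding inner_diff_right by linarith
  moreover have "1/2 * ((1/3) ^ n * norm (y n)) \<ge> real n"
    using y[of n] by (simp add: power_divide field_simps)
  ultimately show False using B[OF yY[of n]] n by linarith
qed

section \<open>Products of projections\<close>

lemma op_prod_Nil [simp]: "op_prod F [] = id"
  by (simp add: op_prod_def)

lemma op_prod_snoc [simp]: "op_prod F (js @ [j]) = F j \<circ> op_prod F js"
  by (simp add: op_prod_def)

lemma op_prod_closed:
  assumes "P id" "\<And>j G. j \<in> set js \<Longrightarrow> P G \<Longrightarrow> P (F j \<circ> G)"
  shows "P (op_prod F js)"
  using assms(2)
proof (induction js rule: rev_induct)
  case Nil
  then show ?case using assms(1) by (simp only: op_prod_Nil)
next
  case (snoc j js)
  then show ?case by simp
qed

lemma bounded_linear_op_prod: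
  assumes "\<And>j. j \<in> set js \<Longrightarrow> bounded_linear (F j)"
  shows "bounded_linear (op_prod F js)"
  by (rule op_prod_closed)
    (auto simp: o_def id_def bounded_linear_ident assms intro: bounded_linear_compose)

text \<open>By Pythagoras the squared norm drops in each projection step by the squared length of
  that step. Splitting a square of a sum costs a factor 2 per step. The first conjunct carries the
  induction, since it controls the distance to the next subspace.\<close>

lemma op_prod_metric_proj_dist_le:
  fixes U :: "nat \<Rightarrow> 'a::{real_inner, complete_space} set" and x :: 'a
  assumes "\<And>i. i \<in> set js \<Longrightarrow> subspace (U i)" "\<And>i. i \<in> set js \<Longrightarrow> closed (U i)"
  defines "y \<equiv> op_prod (\<lambda>i. metric_proj (U i)) js x"
  shows "(norm (x - y))\<^sup>2 \<le> 2 ^ length js * ((norm x)\<^sup>2 - (norm y)\<^sup>2) \<and>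
    (\<forall>i\<in>set js. (norm (x - metric_proj (U i) x))\<^sup>2 \<le> 2 ^ length js * ((norm x)\<^sup>2 - (norm y)\<^sup>2))"
  using assms(1,2) unfolding y_def
proof (induction js rule: rev_induct)
  case (snoc k js)
  define y where "y = op_prod (\<lambda>i. metric_proj (U i)) js x"
  define y' where "y' = metric_proj (U k) y"
  define N where "N = (2::real) ^ length js"
  have k: "subspace (U k)" "closed (U k)" using snoc.prems by simp_all
  have IH: "(norm (x - y))\<^sup>2 \<le> N * ((norm x)\<^sup>2 - (norm y)\<^sup>2)"
    "\<And>i. i \<in> set js \<Longrightarrow> (norm (x - metric_proj (U i) x))\<^sup>2 \<le> N * ((norm x)\<^sup>2 - (norm y)\<^sup>2)"
    using snoc unfolding y_def N_def by auto
  have N: "N \<ge> 1" by (simp add: N_def)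
  have pyth: "(norm y)\<^sup>2 = (norm y')\<^sup>2 + (norm (y - y'))\<^sup>2"
    unfolding y'_def by (rule metric_proj_pythagoras[OF k])
  have nn: "0 \<le> N * ((norm x)\<^sup>2 - (norm y)\<^sup>2)" using order_trans[OF zero_le_power2 IH(1)] .
  have Nb: "(norm (y - y'))\<^sup>2 \<le> N * (norm (y - y'))\<^sup>2" using N by (simp add: mult_le_cancel_right1)
  have gap: "2 * N * ((norm x)\<^sup>2 - (norm y')\<^sup>2)
      = 2 * (N * ((norm x)\<^sup>2 - (norm y)\<^sup>2)) + 2 * (N * (norm (y - y'))\<^sup>2)"
    unfolding pyth by (simp add: algebra_simps)
  have "norm (x - y') \<le> norm (x - y) + norm (y - y')"
    by (rule order_trans[OF _ norm_triangle_ineq]) simp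
  then have "(norm (x - y'))\<^sup>2 \<le> (norm (x - y) + norm (y - y'))\<^sup>2" by (rule power_mono) simp
  also have "\<dots> \<le> 2 * (norm (x - y))\<^sup>2 + 2 * (norm (y - y'))\<^sup>2"
    using zero_le_power2[of "norm (x - y) - norm (y - y')"] by (simp add: power2_sum power2_diff)
  also have "\<dots> \<le> 2 * N * ((norm x)\<^sup>2 - (norm y')\<^sup>2)" using IH(1) Nb gap by linarith
  finally have 1: "(norm (x - y'))\<^sup>2 \<le> 2 * N * ((norm x)\<^sup>2 - (norm y')\<^sup>2)" .
  \<comment> \<open>The point \<open>y'\<close> lies in \<open>U k\<close>, so it competes with the
    nearest point to \<open>x\<close>.\<close>
  have "norm (x - metric_proj (U k) x) \<le> norm (x - y')"
    unfolding y'_def by (intro metric_proj_nearest metric_proj_in k)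
  then have "(norm (x - metric_proj (U k) x))\<^sup>2 \<le> 2 * N * ((norm x)\<^sup>2 - (norm y')\<^sup>2)"
    by (rule order_trans[OF power_mono 1]) simp
  moreover have "(norm (x - metric_proj (U i) x))\<^sup>2 \<le> 2 * N * ((norm x)\<^sup>2 - (norm y')\<^sup>2)"
    if "i \<in> set js" for i
    using IH(2)[OF that] nn Nb gap zero_le_power2[of "norm (y - y')"] by linarith
  ultimately show ?case using 1 by (simp add: y_def y'_def N_def)
qed simp

section \<open>Linear regularity\<close>

text \<open>The complement of the sum is the intersection; taking complements once more returns the
  sum itself because it is a closed subspace.\<close>

lemma orthogonal_comp_INT:
  fixes U :: "'i \<Rightarrow> 'a::{real_inner, complete_space} set"
  assumes "finite I"
    and U: "\<And>i. i \<in> I \<Longrightarrow> subspace (U i)" "\<And>i. i \<in> I \<Longrightarrow> closed (U i)"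
    and cl: "closed (\<Sum>i\<in>I. (U i)\<^sup>\<bottom>)"
  shows "(\<Inter>i\<in>I. U i)\<^sup>\<bottom> = (\<Sum>i\<in>I. (U i)\<^sup>\<bottom>)"
proof -
  let ?W = "\<Sum>i\<in>I. (U i)\<^sup>\<bottom>"
  have alt: "?W = {sum s I | s. \<forall>i\<in>I. s i \<in> (U i)\<^sup>\<bottom>}" by (rule set_sum_alt[OF \<open>finite I\<close>])
  have W: "subspace ?W"
  proof (rule subspaceI)
    show "0 \<in> ?W" unfolding alt
      using subspace_0[OF subspace_orthogonal_comp] by (auto intro!: exI[of _ "\<lambda>_. 0"])
    show "x + y \<in> ?W" if xy: "x \<in> ?W" "y \<in> ?W" for x y
    proof -
      obtain s t where "x = sum s I" "y = sum t I"
        "\<forall>i\<in>I. s i \<in> (U i)\<^sup>\<bottom>" "\<forall>i\<in>I. t i \<in> (U i)\<^sup>\<bottom>" using xy unfolding alt by blast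
      then show ?thesis unfolding alt
        by (auto intro!: exI[of _ "\<lambda>i. s i + t i"] subspace_add[OF subspace_orthogonal_comp]
            simp: sum.distrib)
    qed
    show "c *\<^sub>R x \<in> ?W" if x: "x \<in> ?W" for c x
    proof -
      obtain s where "x = sum s I" "\<forall>i\<in>I. s i \<in> (U i)\<^sup>\<bottom>" using x unfolding alt by blast
      then show ?thesis unfolding alt
        by (auto intro!: exI[of _ "\<lambda>i. c *\<^sub>R s i"] subspace_scale[OF subspace_orthogonal_comp]
            simp: scaleR_sum_right)
    qed
  qed
  have "?W\<^sup>\<bottom> = (\<Inter>i\<in>I. U i)"
  proof
    show "?W\<^sup>\<bottom> \<subseteq> (\<Inter>i\<in>I. U i)"
    proof
      fix x assume x: "x \<in> ?W\<^sup>\<bottom>"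
      have "x \<in> U i" if i: "i \<in> I" for i
      proof -
        have "(U i)\<^sup>\<bottom> \<subseteq> ?W"
        proof
          fix u assume u: "u \<in> (U i)\<^sup>\<bottom>"
          have "sum (\<lambda>j. if j = i then u else 0) I = u" using i \<open>finite I\<close> by simp
          then show "u \<in> ?W" unfolding alt
            using u subspace_0[OF subspace_orthogonal_comp]
            by (auto intro!: exI[of _ "\<lambda>j. if j = i then u else 0"])
        qed
        then have "x \<in> (U i)\<^sup>\<bottom>\<^sup>\<bottom>" using x orthogonal_comp_anti_mono by blast
        then show ?thesis using orthogonal_comp_comp[OF U[OF i]] by simp
      qed
      then show "x \<in> (\<Inter>i\<in>I. U i)" by blast
    qed
    show "(\<Inter>i\<in>I. U i) \<subseteq> ?W\<^sup>\<bottom>"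
      unfolding alt
      by (auto simp: orthogonal_comp_def orthogonal_def inner_sum_left inner_commute[of "sum _ _"]
          inner_commute[of _ "sum _ _"] intro!: sum.neutral) (metis inner_commute)
  qed
  then show ?thesis using orthogonal_comp_comp[OF W cl] by simp
qed

text \<open>An arbitrary common bound \<open>d\<close> replaces the maximal distance, so no maximum
  over \<open>I\<close> has to be formed. The norm bound on \<open>Y\<close> becomes the constant
  after scaling by \<open>d\<close>.\<close>

lemma linear_regularity:
  fixes U :: "'i \<Rightarrow> 'a::{real_inner, complete_space} set"
  assumes "finite I"
    and U: "\<And>i. i \<in> I \<Longrightarrow> subspace (U i)" "\<And>i. i \<in> I \<Longrightarrow> closed (U i)"
    and cl: "closed (\<Sum>i\<in>I. (U i)\<^sup>\<bottom>)"
  shows "\<exists>\<kappa>\<ge>1. \<forall>x\<in>(\<Inter>i\<in>I. U i)\<^sup>\<bottom>. \<forall>d\<ge>0.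
    (\<forall>i\<in>I. norm (x - metric_proj (U i) x) \<le> d) \<longrightarrow> norm x \<le> \<kappa> * d"
proof -
  define M where "M = (\<Inter>i\<in>I. U i)"
  define Y where "Y = {y \<in> M\<^sup>\<bottom>. \<forall>i\<in>I. norm (y - metric_proj (U i) y) \<le> 1}"
  have M: "subspace M" "closed M"
    unfolding M_def using U by (auto intro!: subspace_Inter)
  have N: "subspace (M\<^sup>\<bottom>)" "closed (M\<^sup>\<bottom>)"
    by (rule subspace_orthogonal_comp closed_orthogonal_comp)+
  have "bounded Y"
  proof (rule bounded_if_weakly_bounded)
    fix v
    \<comment> \<open>Elements of \<open>Y\<close> lie in \<open>M\<^sup>\<bottom>\<close>, so only
      the component of \<open>v\<close> there matters, and that component splits into vectors of the
      complements.\<close>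
    have "metric_proj (M\<^sup>\<bottom>) v \<in> (\<Sum>i\<in>I. (U i)\<^sup>\<bottom>)"
      using metric_proj_in[OF N] orthogonal_comp_INT[OF assms] by (simp add: M_def)
    then obtain s where s: "metric_proj (M\<^sup>\<bottom>) v = sum s I" "\<forall>i\<in>I. s i \<in> (U i)\<^sup>\<bottom>"
      by (auto simp: set_sum_alt[OF \<open>finite I\<close>])
    have "\<bar>y \<bullet> v\<bar> \<le> (\<Sum>i\<in>I. norm (s i))" if y: "y \<in> Y" for y
    proof -
      have "(v - metric_proj (M\<^sup>\<bottom>) v) \<bullet> y = 0"
        using y by (intro metric_proj_orthogonal[OF N]) (simp add: Y_def)
      then have "y \<bullet> v = (\<Sum>i\<in>I. y \<bullet> s i)"
        by (simp add: inner_diff s inner_sum_right inner_commute)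
      also have "\<dots> = (\<Sum>i\<in>I. (y - metric_proj (U i) y) \<bullet> s i)"
      proof (rule sum.cong)
        fix i assume i: "i \<in> I"
        then have "metric_proj (U i) y \<bullet> s i = 0"
          using s(2) metric_proj_in[OF U[OF i], of y]
          by (simp add: orthogonal_comp_def orthogonal_def)
        then show "y \<bullet> s i = (y - metric_proj (U i) y) \<bullet> s i" by (simp add: inner_diff)
      qed simp
      also have "\<bar>\<dots>\<bar> \<le> (\<Sum>i\<in>I. norm (s i))"
      proof (rule order_trans[OF sum_abs sum_mono])
        fix i assume "i \<in> I"
        then have "norm (y - metric_proj (U i) y) * norm (s i) \<le> 1 * norm (s i)"
          using y by (intro mult_right_mono) (auto simp: Y_def)
        then show "\<bar>(y - metric_proj (U i) y) \<bullet> s i\<bar> \<le> norm (s i)"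
          using Cauchy_Schwarz_ineq2[of "y - metric_proj (U i) y" "s i"] by simp
      qed
      finally show ?thesis .
    qed
    then show "bounded ((\<lambda>y. y \<bullet> v) ` Y)" by (auto simp: bounded_iff)
  qed
  then obtain b where b: "\<And>y. y \<in> Y \<Longrightarrow> norm y \<le> b" by (auto simp: bounded_iff)
  define \<kappa> where "\<kappa> = max 1 b"
  have "norm x \<le> \<kappa> * d"
    if x: "x \<in> M\<^sup>\<bottom>" and d: "\<And>i. i \<in> I \<Longrightarrow> norm (x - metric_proj (U i) x) \<le> d" and "0 \<le> d" for x d
  \<comment> \<open>Scaling by \<open>1/d\<close> requires \<open>d\<close> nonzero. If
    \<open>d = 0\<close>, then \<open>x\<close> lies in every \<open>U i\<close>, hence in
    \<open>M\<close> as well as in its complement.\<close>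
  proof (cases "d = 0")
    case True
    then have "x \<in> M"
      unfolding M_def using d metric_proj_in[OF U, of _ x] by fastforce
    with x have "x = 0" by (auto simp: orthogonal_comp_def orthogonal_def)
    then show ?thesis using True by simp
  next
    case False
    with \<open>0 \<le> d\<close> have d0: "d > 0" by simp
    have "(1/d) *\<^sub>R x \<in> Y"
    proof -
      have "norm ((1/d) *\<^sub>R x - metric_proj (U i) ((1/d) *\<^sub>R x)) \<le> 1" if i: "i \<in> I" for i
      proof -
        interpret P: bounded_linear "metric_proj (U i)" by (rule bounded_linear_metric_proj[OF U[OF i]])
        have "(1/d) *\<^sub>R x - metric_proj (U i) ((1/d) *\<^sub>R x) = (1/d) *\<^sub>R (x - metric_proj (U i) x)"
          by (simp add: P.scaleR algebra_simps)
        then show ?thesis using d[OF i] d0 by simp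
      qed
      then show ?thesis using x by (simp add: Y_def subspace_scale[OF N(1)])
    qed
    then have "norm ((1/d) *\<^sub>R x) \<le> \<kappa>" using b \<kappa>_def by fastforce
    then show ?thesis using d0 by (simp add: field_simps)
  qed
  moreover have "\<kappa> \<ge> 1" by (simp add: \<kappa>_def)
  ultimately show ?thesis unfolding M_def[symmetric] by (intro exI[of _ \<kappa>]) simp
qed

lemma onorm_op_prod_metric_proj_less_1:
  fixes U :: "nat \<Rightarrow> 'a::{real_inner, complete_space} set"
  assumes U: "\<And>i. i \<in> set js \<Longrightarrow> subspace (U i)" "\<And>i. i \<in> set js \<Longrightarrow> closed (U i)"
    and cl: "closed (\<Sum>i\<in>set js. (U i)\<^sup>\<bottom>)"
  shows "onorm (op_prod (\<lambda>i. metric_proj (U i)) js \<circ> metric_proj ((\<Inter>i\<in>set js. U i)\<^sup>\<bottom>)) < 1"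
proof -
  let ?N = "(\<Inter>i\<in>set js. U i)\<^sup>\<bottom>"
  let ?Q = "op_prod (\<lambda>i. metric_proj (U i)) js"
  have N: "subspace ?N" "closed ?N"
    by (rule subspace_orthogonal_comp closed_orthogonal_comp)+
  have "\<exists>\<kappa>\<ge>1. \<forall>x\<in>?N. \<forall>d\<ge>0.
      (\<forall>i\<in>set js. norm (x - metric_proj (U i) x) \<le> d) \<longrightarrow> norm x \<le> \<kappa> * d"
    by (rule linear_regularity) (simp_all add: U cl)
  then obtain \<kappa> where "\<kappa> \<ge> 1" and \<kappa>: "\<forall>x\<in>?N. \<forall>d\<ge>0.
      (\<forall>i\<in>set js. norm (x - metric_proj (U i) x) \<le> d) \<longrightarrow> norm x \<le> \<kappa> * d"
    by (elim exE conjE)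
  \<comment> \<open>Squaring \<open>norm x \<le> \<kappa> * d\<close> bounds the squared norm by
    \<open>K\<close> times its loss under the product, so the product shrinks it by the factor
    \<open>1 - 1/K\<close>; \<open>K \<ge> 1\<close> keeps this factor nonnegative.\<close>
  define K where "K = \<kappa>\<^sup>2 * 2 ^ length js"
  have K: "K \<ge> 1" unfolding K_def
    using \<open>\<kappa> \<ge> 1\<close> by (metis one_le_numeral one_le_power mult_ge1_I)
  have contr: "(norm (?Q x))\<^sup>2 \<le> (1 - 1/K) * (norm x)\<^sup>2" if x: "x \<in> ?N" for x
  proof -
    define d where "d = sqrt (2 ^ length js * ((norm x)\<^sup>2 - (norm (?Q x))\<^sup>2))"
    have "(norm (x - ?Q x))\<^sup>2 \<le> 2 ^ length js * ((norm x)\<^sup>2 - (norm (?Q x))\<^sup>2) \<and>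
        (\<forall>i\<in>set js. (norm (x - metric_proj (U i) x))\<^sup>2 \<le> 2 ^ length js * ((norm x)\<^sup>2 - (norm (?Q x))\<^sup>2))"
      by (rule op_prod_metric_proj_dist_le) (rule U, assumption)+
    then have dist0: "(norm (x - ?Q x))\<^sup>2 \<le> 2 ^ length js * ((norm x)\<^sup>2 - (norm (?Q x))\<^sup>2)"
      and dist: "\<forall>i\<in>set js. (norm (x - metric_proj (U i) x))\<^sup>2 \<le> 2 ^ length js * ((norm x)\<^sup>2 - (norm (?Q x))\<^sup>2)"
      by (rule conjunct1, rule conjunct2)
    have nn: "0 \<le> 2 ^ length js * ((norm x)\<^sup>2 - (norm (?Q x))\<^sup>2)"
      by (rule order_trans[OF zero_le_power2 dist0])
    have d2: "d\<^sup>2 = 2 ^ length js * ((norm x)\<^sup>2 - (norm (?Q x))\<^sup>2)"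
      unfolding d_def by (rule real_sqrt_pow2[OF nn])
    have "0 \<le> d" unfolding d_def by (rule real_sqrt_ge_zero[OF nn])
    have "norm x \<le> \<kappa> * d"
    proof (rule \<kappa>[rule_format, OF x \<open>0 \<le> d\<close>])
      fix i assume "i \<in> set js"
      then have "(norm (x - metric_proj (U i) x))\<^sup>2 \<le> d\<^sup>2" unfolding d2 using dist by blast
      then show "norm (x - metric_proj (U i) x) \<le> d" using \<open>0 \<le> d\<close> by (rule power2_le_imp_le)
    qed
    then have "(norm x)\<^sup>2 \<le> (\<kappa> * d)\<^sup>2" by (rule power_mono) simp
    also have "\<dots> = K * ((norm x)\<^sup>2 - (norm (?Q x))\<^sup>2)" by (simp add: power_mult_distrib d2 K_def)
    finally show ?thesis using K by (simp add: field_simps)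
  qed
  have "onorm (?Q \<circ> metric_proj ?N) \<le> sqrt (1 - 1/K)"
  proof (rule onorm_bound)
    fix x
    have "(norm (?Q (metric_proj ?N x)))\<^sup>2 \<le> (1 - 1/K) * (norm (metric_proj ?N x))\<^sup>2"
      by (rule contr[OF metric_proj_in[OF N]])
    also have "\<dots> \<le> (1 - 1/K) * (norm x)\<^sup>2"
      using K norm_metric_proj_le[OF N, of x] by (intro mult_left_mono power_mono) auto
    also have "\<dots> = (sqrt (1 - 1/K) * norm x)\<^sup>2" using K by (simp add: power_mult_distrib)
    finally have "norm (?Q (metric_proj ?N x)) \<le> sqrt (1 - 1/K) * norm x"
      by (rule power2_le_imp_le) (use K in simp)
    then show "norm ((?Q \<circ> metric_proj ?N) x) \<le> sqrt (1 - 1/K) * norm x" by simp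
  qed (use K in simp)
  also have "\<dots> < 1" using K by simp
  finally show ?thesis .
qed

section \<open>Circumcenters\<close>

text \<open>One Gram-Schmidt step per vector: \<open>c\<close> is the part of \<open>b\<close>
  orthogonal to \<open>span B\<close>, and the projection of \<open>x\<close> onto the line of
  \<open>c\<close> is added to the one onto \<open>span B\<close>.\<close>

lemma finite_span_orthogonal_decomposition:
  fixes B :: "'a::real_inner set"
  assumes "finite B"
  shows "\<exists>p\<in>span B. \<forall>u\<in>span B. (x - p) \<bullet> u = 0"
  using assms
proof (induction B arbitrary: x)
  case (insert b B)
  obtain q where q: "q \<in> span B" "\<forall>u\<in>span B. (x - q) \<bullet> u = 0" using insert.IH by blast
  obtain r where r: "r \<in> span B" "\<forall>u\<in>span B. (b - r) \<bullet> u = 0" using insert.IH by blast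
  define c where "c = b - r"
  \<comment> \<open>If \<open>c = 0\<close>, then \<open>b\<close> already lies in
    \<open>span B\<close>; division by zero makes \<open>t\<close> zero and \<open>q\<close> is
    kept.\<close>
  define t where "t = ((x - q) \<bullet> c) / (c \<bullet> c)"
  have sub: "span B \<subseteq> span (insert b B)" by (simp add: span_mono subset_insertI)
  have c: "c \<in> span (insert b B)" unfolding c_def
    using r sub by (intro span_diff) (auto intro: span_base)
  have tc: "(x - q - t *\<^sub>R c) \<bullet> c = 0" by (cases "c = 0") (simp_all add: t_def inner_diff)
  have "(x - (q + t *\<^sub>R c)) \<bullet> u = 0" if "u \<in> span (insert b B)" for u
  proof -
    from that obtain k where k: "u - k *\<^sub>R b \<in> span B" by (auto simp: span_insert)
    define w where "w = u - k *\<^sub>R b + k *\<^sub>R r"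
    have w: "w \<in> span B" unfolding w_def using k r by (simp add: span_add span_scale)
    have u: "u = w + k *\<^sub>R c" by (simp add: w_def c_def algebra_simps)
    have "(x - q - t *\<^sub>R c) \<bullet> w = 0"
      using q(2) r(2) w by (simp add: inner_diff_left c_def)
    with tc show ?thesis by (simp add: u inner_add_right diff_diff_eq)
  qed
  moreover have "q + t *\<^sub>R c \<in> span (insert b B)" using q c sub by (auto intro: span_add span_scale)
  ultimately show ?case by blast
qed simp

text \<open>Translating by a point \<open>a\<close> of the hull turns it into the span of finitely
  many differences.\<close>

lemma affine_hull_finite_nearest:
  fixes A :: "'a::real_inner set"
  assumes "finite A" "A \<noteq> {}"
  obtains p where "p \<in> affine hull A" "\<And>y. y \<in> affine hull A \<Longrightarrow> (z - p) \<bullet> (y - p) = 0"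
proof -
  obtain a where a: "a \<in> affine hull A" using \<open>A \<noteq> {}\<close> hull_inc by fastforce
  define V where "V = span ((\<lambda>x. - a + x) ` A)"
  have hull: "affine hull A = (\<lambda>x. a + x) ` V"
    unfolding V_def by (rule affine_hull_span_gen[OF a])
  obtain q where q: "q \<in> V" "\<forall>u\<in>V. ((z - a) - q) \<bullet> u = 0"
    unfolding V_def using finite_span_orthogonal_decomposition[of "(\<lambda>x. - a + x) ` A"] \<open>finite A\<close> by blast
  show ?thesis
  proof (rule that)
    show "a + q \<in> affine hull A" using q hull by blast
    fix y assume "y \<in> affine hull A"
    then obtain v where v: "v \<in> V" "y = a + v" using hull by blast
    have "v - q \<in> V" using v q unfolding V_def by (simp add: span_diff)
    then show "(z - (a + q)) \<bullet> (y - (a + q)) = 0" using q(2) v(2) by (simp add: diff_diff_eq)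
  qed
qed

text \<open>The points \<open>T x\<close> lie on a sphere about \<open>z\<close>. By Pythagoras the
  foot \<open>p\<close> of the perpendicular from \<open>z\<close> to their affine hull is
  equidistant from them, so it is the circumcenter once uniqueness is shown.\<close>

lemma circumcenter_map_nearest:
  assumes fin: "finite S" "S \<noteq> {}"
    and r: "\<And>T. T \<in> S \<Longrightarrow> norm (T x - z) = r"
  shows "circumcenter_map S x \<in> affine hull ((\<lambda>T. T x) ` S)"
    and "y \<in> affine hull ((\<lambda>T. T x) ` S) \<Longrightarrow> norm (circumcenter_map S x - z) \<le> norm (y - z)"
proof -
  let ?A = "(\<lambda>T. T x) ` S"
  obtain p where p: "p \<in> affine hull ?A"
    and orth: "\<And>y. y \<in> affine hull ?A \<Longrightarrow> (z - p) \<bullet> (y - p) = 0"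
    using affine_hull_finite_nearest[of ?A z] fin by blast
  have pyth: "(norm (z - y))\<^sup>2 = (norm (z - p))\<^sup>2 + (norm (y - p))\<^sup>2" if "y \<in> affine hull ?A" for y
    by (rule norm_diff_pythagoras[OF orth[OF that]])
  have eq: "circumcenter_map S x = p"
    unfolding circumcenter_map_def
  proof (rule the_equality, intro conjI)
    have "norm (p - T x) = sqrt (r\<^sup>2 - (norm (z - p))\<^sup>2)" if "T \<in> S" for T
    proof -
      have "T x \<in> affine hull ?A" using that by (simp add: hull_inc)
      from pyth[OF this] r[OF that] have "(norm (p - T x))\<^sup>2 = r\<^sup>2 - (norm (z - p))\<^sup>2"
        by (simp add: norm_minus_commute)
      then show ?thesis by (metis norm_ge_zero real_sqrt_unique)
    qed
    then have "(\<lambda>T. norm (p - T x)) ` S = {sqrt (r\<^sup>2 - (norm (z - p))\<^sup>2)}" using fin(2) by auto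
    then show "is_singleton ((\<lambda>T. norm (p - T x)) ` S)" by simp
    show "p \<in> affine hull ?A" by (rule p)
  next
    fix q assume q: "q \<in> affine hull ?A \<and> is_singleton ((\<lambda>T. norm (q - T x)) ` S)"
    then obtain c where c: "norm (q - T x) = c" if "T \<in> S" for T
      by (auto simp: is_singleton_def)
    obtain T0 where T0: "T0 \<in> S" using fin by blast
    \<comment> \<open>\<open>q\<close> and \<open>z\<close> are both equidistant from the points \<open>T x\<close>, so \<open>q - z\<close> is orthogonal to the
      directions of the affine hull, and so is \<open>q - p\<close>, which is itself such a direction.\<close>
    have "affine {y. (q - z) \<bullet> (y - T0 x) = 0}"
      using affine_hyperplane[of "q - z" "(q - z) \<bullet> T0 x"] by (simp add: inner_diff_right)
    moreover have "?A \<subseteq> {y. (q - z) \<bullet> (y - T0 x) = 0}"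
    proof clarify
      fix T assume T: "T \<in> S"
      have "(norm (q - T x))\<^sup>2 = (norm (q - T0 x))\<^sup>2" "(norm (T x - z))\<^sup>2 = (norm (T0 x - z))\<^sup>2"
        using c r T T0 by simp_all
      then show "(q - z) \<bullet> (T x - T0 x) = 0"
        unfolding norm_diff_sq by (simp add: inner_diff inner_commute)
    qed
    ultimately have "affine hull ?A \<subseteq> {y. (q - z) \<bullet> (y - T0 x) = 0}" by (rule hull_minimal[rotated])
    then have "(q - z) \<bullet> (q - T0 x) = 0" "(q - z) \<bullet> (p - T0 x) = 0" using p q by blast+
    moreover have "(z - p) \<bullet> (q - p) = 0" using q by (blast intro: orth)
    ultimately have "(q - p) \<bullet> (q - p) = 0" by (simp add: inner_diff inner_commute)
    then show "q = p" by simp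
  qed
  show "circumcenter_map S x \<in> affine hull ?A" using eq p by simp
  show "norm (circumcenter_map S x - z) \<le> norm (y - z)" if "y \<in> affine hull ?A"
    unfolding eq using pyth[OF that] by - (rule power2_le_imp_le, simp_all add: norm_minus_commute)
qed

section \<open>Products of projections and reflectors\<close>

lemma refl_Psi_mono: "n \<le> m \<Longrightarrow> refl_Psi n U \<subseteq> refl_Psi m U"
  unfolding refl_Psi_def by fastforce

text \<open>Projecting onto the next subspace takes the midpoint of a point and its reflection. The
  reflector is linear, so it carries the affine hull to that of the reflected points.\<close>

lemma op_prod_metric_proj_in_affine_hull:
  fixes U :: "nat \<Rightarrow> 'a::{real_inner, complete_space} set"
  assumes "\<And>i. i \<in> {1..m} \<Longrightarrow> subspace (U i)" "\<And>i. i \<in> {1..m} \<Longrightarrow> closed (U i)"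
  shows "op_prod (\<lambda>i. metric_proj (U i)) [1..<Suc m] x \<in> affine hull ((\<lambda>T. T x) ` refl_Psi m U)"
  using assms
proof (induction m)
  case 0
  have "id \<in> refl_Psi 0 U" unfolding refl_Psi_def by (auto intro!: exI[of _ "[]"])
  then show ?case by (auto intro!: hull_inc image_eqI[of _ _ id])
next
  case (Suc m)
  let ?A = "\<lambda>n. (\<lambda>T. T x) ` refl_Psi n U"
  define y where "y = op_prod (\<lambda>i. metric_proj (U i)) [1..<Suc m] x"
  have k: "subspace (U (Suc m))" "closed (U (Suc m))" using Suc.prems by simp_all
  have y: "y \<in> affine hull ?A m" unfolding y_def using Suc by simp
  moreover have "affine hull ?A m \<subseteq> affine hull ?A (Suc m)"
    by (intro hull_mono image_mono refl_Psi_mono) simp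
  ultimately have y': "y \<in> affine hull ?A (Suc m)" by blast
  have "reflector (U (Suc m)) y \<in> affine hull (reflector (U (Suc m)) ` ?A m)"
    using y affine_hull_linear_image[OF bounded_linear_reflector[OF k]] by blast
  also have "\<dots> \<subseteq> affine hull ?A (Suc m)"
  proof (rule hull_mono, clarify)
    fix T assume "T \<in> refl_Psi m U"
    then obtain js where js: "T = op_prod (\<lambda>i. reflector (U i)) js" "length js \<le> m"
      "set js \<subseteq> {1..m}" "sorted_wrt (<) js" unfolding refl_Psi_def by blast
    \<comment> \<open>All entries of \<open>js\<close> are at most \<open>m\<close>, so appending
      \<open>Suc m\<close> keeps the list strictly increasing and within the length bound.\<close>
    have "op_prod (\<lambda>i. reflector (U i)) (js @ [Suc m]) \<in> refl_Psi (Suc m) U"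
      unfolding refl_Psi_def using js
      by (intro CollectI exI[of _ "js @ [Suc m]"]) (fastforce simp: sorted_wrt_append)
    from imageI[OF this, of "\<lambda>T. T x"] show "reflector (U (Suc m)) (T x) \<in> ?A (Suc m)"
      by (simp add: js(1))
  qed
  finally have "(1/2) *\<^sub>R y + (1/2) *\<^sub>R reflector (U (Suc m)) y \<in> affine hull ?A (Suc m)"
    by (intro mem_affine[OF affine_affine_hull y']) simp_all
  then have "metric_proj (U (Suc m)) y \<in> affine hull ?A (Suc m)"
    by (simp only: metric_proj_eq_midpoint_reflector[OF k])
  moreover have "[1..<Suc (Suc m)] = [1..<Suc m] @ [Suc m]" by simp
  ultimately show ?case by (simp only: op_prod_snoc o_apply y_def)
qed

text \<open>Every reflector in the product has both properties because \<open>z\<close> lies in each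
  subspace. Together they fix the distance from \<open>T x\<close> to \<open>z\<close>.\<close>

lemma refl_Omega_isometry:
  assumes U: "\<And>i. i \<in> {1..m} \<Longrightarrow> subspace (U i)" "\<And>i. i \<in> {1..m} \<Longrightarrow> closed (U i)"
    and T: "T \<in> refl_Omega m U" and z: "z \<in> (\<Inter>i\<in>{1..m}. U i)"
  shows "norm (T x) = norm x" "T x \<bullet> z = x \<bullet> z"
proof -
  obtain js where js: "T = op_prod (\<lambda>i. reflector (U i)) js" "set js \<subseteq> {1..m}"
    using T unfolding refl_Omega_def by blast
  have "norm (T x) = norm x \<and> T x \<bullet> z = x \<bullet> z"
    unfolding js(1)
  proof (rule op_prod_closed)
    fix j G assume "j \<in> set js" and G: "norm (G x) = norm x \<and> G x \<bullet> z = x \<bullet> z"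
    then have "j \<in> {1..m}" using js by blast
    then have "subspace (U j)" "closed (U j)" "z \<in> U j" using U z by auto
    with G show "norm ((reflector (U j) \<circ> G) x) = norm x \<and> (reflector (U j) \<circ> G) x \<bullet> z = x \<bullet> z"
      by (simp add: norm_reflector inner_reflector)
  qed simp
  then show "norm (T x) = norm x" "T x \<bullet> z = x \<bullet> z" by auto
qed

theorem theorem6p21:
  fixes U :: "nat \<Rightarrow> 'a::{real_inner, complete_space} set"
    and m :: nat
    and S :: "('a \<Rightarrow> 'a) set"
    and \<gamma> :: real
  assumes "m \<ge> 2"
    and "\<And>i. i \<in> {1..m} \<Longrightarrow> subspace (U i)"
    and "\<And>i. i \<in> {1..m} \<Longrightarrow> closed (U i)"
    and "closed (\<Sum>i\<in>{1..m}. (U i)\<^sup>\<bottom>)"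
    and "finite S"
    and "refl_Psi m U \<subseteq> S"
    and "S \<subseteq> refl_Omega m U"
    and "\<gamma> = onorm (op_prod (\<lambda>i. metric_proj (U i)) [1..<Suc m]
                      \<circ> metric_proj ((\<Inter>i\<in>{1..m}. U i)\<^sup>\<bottom>))"
  shows "0 \<le> \<gamma> \<and> \<gamma> < 1
    \<and> Fix (circumcenter_map S) = (\<Inter>i\<in>{1..m}. U i)
    \<and> is_BAM \<gamma> (circumcenter_map S)"
proof -
  define M where "M = (\<Inter>i\<in>{1..m}. U i)"
  let ?Q = "op_prod (\<lambda>i. metric_proj (U i)) [1..<Suc m]"
  let ?CC = "circumcenter_map S"
  note U = assms(2,3)
  have M: "subspace M" "closed M"
    unfolding M_def using U by (auto intro!: subspace_Inter)
  have N: "subspace (M\<^sup>\<bottom>)" "closed (M\<^sup>\<bottom>)"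
    by (rule subspace_orthogonal_comp closed_orthogonal_comp)+
  have set: "set [1..<Suc m] = {1..m}" by auto
  have Q: "bounded_linear ?Q"
    using U by (intro bounded_linear_op_prod bounded_linear_metric_proj) auto
  have bl: "bounded_linear (?Q \<circ> metric_proj (M\<^sup>\<bottom>))"
    unfolding o_def by (rule bounded_linear_compose[OF Q bounded_linear_metric_proj[OF N]])
  have \<gamma>: "\<gamma> = onorm (?Q \<circ> metric_proj (M\<^sup>\<bottom>))" using assms(8) by (simp only: M_def)
  have \<gamma>0: "0 \<le> \<gamma>" unfolding \<gamma> by (rule onorm_pos_le[OF bl])
  have \<gamma>1: "\<gamma> < 1"
    unfolding \<gamma> M_def
    using onorm_op_prod_metric_proj_less_1[of "[1..<Suc m]" U] U assms(4) unfolding set by blast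

  have "id \<in> refl_Psi m U" unfolding refl_Psi_def by (auto intro!: exI[of _ "[]"])
  then have "S \<noteq> {}" using assms(6) by blast
  have iso: "norm (T x) = norm x" "T x \<bullet> z = x \<bullet> z" if "T \<in> S" "z \<in> M" for T x z
    using refl_Omega_isometry[of m U T z x] U assms(7) that unfolding M_def by blast+
  have sphere: "norm (T x - z) = norm (x - z)" if "T \<in> S" "z \<in> M" for T x z
  proof -
    have "(norm (T x - z))\<^sup>2 = (norm (x - z))\<^sup>2"
      unfolding norm_diff_sq using iso[OF that] by simp
    then show ?thesis by simp
  qed
  \<comment> \<open>The centre 0, which lies in \<open>M\<close>, serves for every
    \<open>x\<close>.\<close>
  have CC_hull: "?CC x \<in> affine hull ((\<lambda>T. T x) ` S)" for x
    using circumcenter_map_nearest(1)[OF assms(5) \<open>S \<noteq> {}\<close>] sphere subspace_0[OF M(1)] by blast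
  have CC_near: "norm (?CC x - z) \<le> norm (y - z)"
    if "z \<in> M" "y \<in> affine hull ((\<lambda>T. T x) ` S)" for x y z
    using circumcenter_map_nearest(2)[OF assms(5) \<open>S \<noteq> {}\<close>] sphere that by blast

  have CC_inner: "?CC x \<bullet> z = x \<bullet> z" if z: "z \<in> M" for x z
  proof -
    \<comment> \<open>All \<open>T x\<close> lie in this affine set, hence so does their hull and
      with it the circumcenter. The projection onto \<open>M\<close> is thus unchanged.\<close>
    have "affine {y. y \<bullet> z = x \<bullet> z}"
      using affine_hyperplane[of z "x \<bullet> z"] by (simp add: inner_commute)
    moreover have "(\<lambda>T. T x) ` S \<subseteq> {y. y \<bullet> z = x \<bullet> z}" using iso(2)[OF _ z] by blast
    ultimately have "affine hull ((\<lambda>T. T x) ` S) \<subseteq> {y. y \<bullet> z = x \<bullet> z}" by (rule hull_minimal[rotated])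
    then show ?thesis using CC_hull by blast
  qed
  have proj_CC: "metric_proj M (?CC x) = metric_proj M x" for x
  proof (rule metric_proj_eqI[OF M(1) metric_proj_in[OF M]])
    fix u assume u: "u \<in> M"
    then show "(?CC x - metric_proj M x) \<bullet> u = 0"
      using metric_proj_orthogonal[OF M u, of x] CC_inner[OF u, of x] by (simp add: inner_diff)
  qed
  have contr: "norm (?CC x - metric_proj M x) \<le> \<gamma> * norm (x - metric_proj M x)" for x
  proof -
    define z where "z = metric_proj M x"
    have z: "z \<in> M" unfolding z_def by (rule metric_proj_in[OF M])
    \<comment> \<open>As \<open>z\<close> is fixed by the product and \<open>x - z\<close> by the
      projection onto \<open>M\<^sup>\<bottom>\<close>, linearity turns \<open>?Q x - z\<close> into
      the operator defining \<open>\<gamma>\<close> applied to \<open>x - z\<close>.\<close>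
    have Qz: "?Q z = z"
      using z U by (intro op_prod_closed[where P = "\<lambda>G. G z = z"]) (auto simp: M_def metric_proj_id)
    have "x - z \<in> M\<^sup>\<bottom>"
      using metric_proj_orthogonal[OF M] unfolding z_def
      by (simp add: orthogonal_comp_def orthogonal_def inner_commute)
    then have xz: "metric_proj (M\<^sup>\<bottom>) (x - z) = x - z" by (rule metric_proj_id[OF N])
    have "?Q x \<in> affine hull ((\<lambda>T. T x) ` refl_Psi m U)"
      using U by (rule op_prod_metric_proj_in_affine_hull)
    then have "?Q x \<in> affine hull ((\<lambda>T. T x) ` S)"
      using hull_mono[OF image_mono[OF assms(6)], of affine "\<lambda>T. T x"] by blast
    then have "norm (?CC x - z) \<le> norm (?Q x - z)" by (rule CC_near[OF z])
    also have "?Q x - z = (?Q \<circ> metric_proj (M\<^sup>\<bottom>)) (x - z)"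
      by (simp only: o_apply xz linear_diff[OF bounded_linear.linear[OF Q]] Qz)
    also have "norm \<dots> \<le> \<gamma> * norm (x - z)" unfolding \<gamma> by (rule onorm[OF bl])
    finally show ?thesis unfolding z_def .
  qed
  have Fix: "Fix ?CC = M"
  proof
    show "Fix ?CC \<subseteq> M"
    proof
      fix x assume "x \<in> Fix ?CC"
      \<comment> \<open>At a fixed point the contraction bounds the distance to \<open>M\<close> by
        \<open>\<gamma>\<close> times itself, so it vanishes.\<close>
      then have "(1 - \<gamma>) * norm (x - metric_proj M x) \<le> 0"
        using contr[of x] by (simp add: Fix_def algebra_simps)
      then have "x = metric_proj M x" using \<gamma>1 by (simp add: mult_le_0_iff)
      then show "x \<in> M" using metric_proj_in[OF M, of x] by simp
    qed
    show "M \<subseteq> Fix ?CC"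
    proof
      fix x assume x: "x \<in> M"
      have "norm (?CC x - x) \<le> 0" using contr[of x] metric_proj_id[OF M x] by simp
      then show "x \<in> Fix ?CC" by (simp add: Fix_def)
    qed
  qed
  have "is_BAM \<gamma> ?CC"
    unfolding is_BAM_def Fix
    using \<gamma>0 \<gamma>1 M subspace_0[OF M(1)] subspace_imp_convex[OF M(1)] proj_CC contr
    by (auto simp: fun_eq_iff)
  then show ?thesis using \<gamma>0 \<gamma>1 Fix by (simp add: M_def)
qed

end
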